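(* Let $r,s$ be positive integers with $s\ge r$, let $X,E$ be finite sets with $|X|=r$ and $|E|=s$, and let $A$ be an $X\times E$ matrix over the quaternions $\mathbb{H}$. Then $$\delta(AA^\dagger)=\sum_{B\subseteq E:\ |B|=r}\delta\big(A[X,B]\,A[X,B]^\dagger\big).$$
   Context: $\mathbb{H}$ is the skew field of real quaternions. For $p=a+bi+cj+dk$, $\bar p=a-bi-cj-dk$. For a matrix $A$ over $\mathbb{H}$, $A^\dagger$ is its conjugate transpose ($(A^\dagger)_{uv}=\overline{A_{vu}}$). Let $\phi:\mathbb{H}\to M(2,\mathbb{C})$ be $\phi(a+bi+cj+dk)=\begin{bmatrix}a+bi&c+di\\-c+di&a-bi\end{bmatrix}$, applied entrywise to matrices. For an $r\times s$ matrix $A'$ with entries in $M(2,\mathbb{C})$, the unwrapping $z_2(A')$ is the $2r\times 2s$ complex matrix obtained by replacing each entry by its $2\times2$ block (so $z_2(A')[2(a-1)+c,2(b-1)+d]$ is the $(c,d)$ entry of $A'[a,b]$). For a square matrix $D$ over $\mathbb{H}$ (rows and columns in some fixed order), $\delta(D):=\sqrt{|\det(z_2(\phi(D)))|}$. $A[X,B]$ denotes the submatrix of $A$ with columns in $B$. *)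

theory Defs
  imports Complex_Main "Jordan_Normal_Form.Determinant"
begin

text \<open>\<open>Quat a b c d\<close> stands for \<open>a + b i + c j + d k\<close>.\<close>

datatype quat = Quat (qre: real) (qi: real) (qj: real) (qk: real)

lemma quat_eq_iff:
  "p = q \<longleftrightarrow> qre p = qre q \<and> qi p = qi q \<and> qj p = qj q \<and> qk p = qk q"
  by (cases p; cases q) simp

definition qcnj :: "quat \<Rightarrow> quat" where
  "qcnj p = Quat (qre p) (- qi p) (- qj p) (- qk p)"

text \<open>Multiplication is determined by \<open>i\<^sup>2 = j\<^sup>2 = k\<^sup>2 = i j k = -1\<close>; the inverse of \<open>p\<close> is its
  conjugate divided by the squared norm (hence \<open>0\<close> for \<open>p = 0\<close>).\<close>

instantiation quat :: division_ring
begin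

definition zero_quat :: quat where "zero_quat = Quat 0 0 0 0"

definition one_quat :: quat where "one_quat = Quat 1 0 0 0"

definition plus_quat :: "quat \<Rightarrow> quat \<Rightarrow> quat" where
  "plus_quat p q = Quat (qre p + qre q) (qi p + qi q) (qj p + qj q) (qk p + qk q)"

definition uminus_quat :: "quat \<Rightarrow> quat" where
  "uminus_quat p = Quat (- qre p) (- qi p) (- qj p) (- qk p)"

definition minus_quat :: "quat \<Rightarrow> quat \<Rightarrow> quat" where
  "minus_quat p q = Quat (qre p - qre q) (qi p - qi q) (qj p - qj q) (qk p - qk q)"

definition times_quat :: "quat \<Rightarrow> quat \<Rightarrow> quat" where
  "times_quat p q = Quat
     (qre p * qre q - qi p * qi q - qj p * qj q - qk p * qk q)
     (qre p * qi q + qi p * qre q + qj p * qk q - qk p * qj q)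
     (qre p * qj q - qi p * qk q + qj p * qre q + qk p * qi q)
     (qre p * qk q + qi p * qj q - qj p * qi q + qk p * qre q)"

definition inverse_quat :: "quat \<Rightarrow> quat" where
  "inverse_quat p = (let n = (qre p)\<^sup>2 + (qi p)\<^sup>2 + (qj p)\<^sup>2 + (qk p)\<^sup>2
     in Quat (qre p / n) (- qi p / n) (- qj p / n) (- qk p / n))"

definition divide_quat :: "quat \<Rightarrow> quat \<Rightarrow> quat" where
  "divide_quat p q = p * inverse q"

instance
proof
  fix p :: quat
  assume p: "p \<noteq> 0"
  define n where "n = (qre p)\<^sup>2 + (qi p)\<^sup>2 + (qj p)\<^sup>2 + (qk p)\<^sup>2"
  have n: "n \<noteq> 0"
    using p unfolding n_def
    by (auto simp: quat_eq_iff zero_quat_def add_nonneg_eq_0_iff)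
  have inv: "inverse p = Quat (qre p / n) (- qi p / n) (- qj p / n) (- qk p / n)"
    by (simp add: inverse_quat_def n_def Let_def)
  have re: "qre p * qre p / n + qi p * qi p / n + qj p * qj p / n + qk p * qk p / n = 1"
    using n by (simp add: n_def power2_eq_square flip: add_divide_distrib)
  show "inverse p * p = 1" and "p * inverse p = 1"
    using re by (simp_all add: inv times_quat_def one_quat_def mult.commute)
qed (auto simp: quat_eq_iff zero_quat_def one_quat_def plus_quat_def uminus_quat_def
       minus_quat_def times_quat_def divide_quat_def inverse_quat_def algebra_simps)

end

text \<open>An \<open>X \<times> E\<close> matrix is a function \<open>A\<close> of which only the entries \<open>A x e\<close> with
  \<open>x \<in> X\<close> and \<open>e \<in> E\<close> matter.\<close>

type_synonym ('x, 'e) qmat = "'x \<Rightarrow> 'e \<Rightarrow> quat"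

definition qadj :: "('x, 'e) qmat \<Rightarrow> ('e, 'x) qmat" where
  "qadj A = (\<lambda>u v. qcnj (A v u))"

text \<open>\<open>qmat_mult E A C\<close> is the product \<open>A C\<close>, where \<open>E\<close> indexes the columns of \<open>A\<close> and the
  rows of \<open>C\<close>.\<close>

definition qmat_mult :: "'e set \<Rightarrow> ('x, 'e) qmat \<Rightarrow> ('e, 'y) qmat \<Rightarrow> ('x, 'y) qmat" where
  "qmat_mult E A C = (\<lambda>u v. \<Sum>e\<in>E. A u e * C e v)"

text \<open>The submatrix \<open>A[X,B]\<close>, padded with \<open>0\<close> outside of \<open>X \<times> B\<close>.\<close>

definition qsubmat :: "('x, 'e) qmat \<Rightarrow> 'x set \<Rightarrow> 'e set \<Rightarrow> ('x, 'e) qmat" where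
  "qsubmat A X B = (\<lambda>x e. if x \<in> X \<and> e \<in> B then A x e else 0)"

definition phi :: "quat \<Rightarrow> complex mat" where
  "phi p = mat_of_rows_list 2
     [[Complex (qre p) (qi p), Complex (qj p) (qk p)],
      [Complex (- qj p) (qk p), Complex (qre p) (- qi p)]]"

text \<open>Indices start at \<open>0\<close>, so entry \<open>(2 a + c, 2 b + d)\<close> of the unwrapping is entry
  \<open>(c, d)\<close> of the block at \<open>(a, b)\<close>.\<close>

definition z2 :: "complex mat mat \<Rightarrow> complex mat" where
  "z2 M = mat (2 * dim_row M) (2 * dim_col M)
     (\<lambda>(i, j). (M $$ (i div 2, j div 2)) $$ (i mod 2, j mod 2))"

text \<open>The lists \<open>xs\<close> and \<open>ys\<close> enumerate the row and column index sets and thereby fix the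
  orders of the rows and columns.\<close>

definition ordered_mat :: "'x list \<Rightarrow> 'y list \<Rightarrow> ('x, 'y) qmat \<Rightarrow> quat mat" where
  "ordered_mat xs ys D = mat (length xs) (length ys) (\<lambda>(i, j). D (xs ! i) (ys ! j))"

definition delta :: "'x list \<Rightarrow> 'y list \<Rightarrow> ('x, 'y) qmat \<Rightarrow> real" where
  "delta xs ys D = sqrt (cmod (det (z2 (map_mat phi (ordered_mat xs ys D)))))"

end

theory Submission
  imports Defs
begin

text \<open>Write \<open>A A\<^sup>\<dagger>\<close> as the sum of the rank one matrices \<open>a a\<^sup>\<dagger>\<close> over the columns \<open>a\<close> of \<open>A\<close>, and
  give each summand a weight \<open>w\<close>. For a positive definite \<open>M\<close> the unwrapped form of
  \<open>a\<^sup>\<dagger> M\<^sup>-\<^sup>1 a\<close> is a real scalar \<open>c \<ge> 0\<close> times the \<open>2 \<times> 2\<close> identity, so by the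
  determinant lemma the complex determinant is multiplied by \<open>(1 + w c)\<^sup>2\<close> when \<open>w a a\<^sup>\<dagger>\<close> is added
  to \<open>M\<close>, and its square root \<open>\<delta>\<close> is affine in \<open>w\<close>. Perturbing by \<open>\<epsilon> I\<close> and letting
  \<open>\<epsilon> \<rightarrow> 0\<close> shows that \<open>\<delta>\<close> of the weighted sum is affine in each weight.
  It is also homogeneous of degree \<open>r\<close>, hence, with all weights equal to \<open>l\<close> and \<open>g B\<close> the
  value for the indicator function of \<open>B\<close> as weights,
  \<open>l\<^sup>r g E = \<Sum>B\<subseteq>E. l\<^bsup>card B\<^esup> (1 - l)\<^bsup>card E - card B\<^esup> g B\<close>.
  By induction this forces \<open>g B = 0\<close> for \<open>card B < r\<close>; dividing by \<open>l\<^sup>r\<close> and letting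
  \<open>l \<rightarrow> 0\<close> leaves the sets with \<open>card B = r\<close>. Different orders of the rows and columns only
  contribute a constant factor.\<close>

section \<open>Quaternions as complex matrices\<close>

lemmas quat_arith = zero_quat_def one_quat_def plus_quat_def uminus_quat_def minus_quat_def
  times_quat_def

lemma quat_add_simps [simp]:
  "qre (p + q) = qre p + qre q" "qi (p + q) = qi p + qi q"
  "qj (p + q) = qj p + qj q" "qk (p + q) = qk p + qk q"
  by (simp_all add: plus_quat_def)

lemma quat_zero_simps [simp]: "qre 0 = 0" "qi 0 = 0" "qj 0 = 0" "qk 0 = 0"
  by (simp_all add: zero_quat_def)

lemma quat_sum_simps:
  "qre (sum f S) = (\<Sum>e\<in>S. qre (f e))" "qi (sum f S) = (\<Sum>e\<in>S. qi (f e))"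
  "qj (sum f S) = (\<Sum>e\<in>S. qj (f e))" "qk (sum f S) = (\<Sum>e\<in>S. qk (f e))"
  by (induction S rule: infinite_finite_induct) simp_all

lemma qcnj_zero [simp]: "qcnj 0 = 0"
  by (simp add: qcnj_def quat_arith)

lemma qcnj_add: "qcnj (p + q) = qcnj p + qcnj q"
  by (simp add: qcnj_def quat_arith)

lemma qcnj_mult: "qcnj (p * q) = qcnj q * qcnj p"
  by (simp add: qcnj_def quat_arith algebra_simps)

lemma qcnj_qcnj [simp]: "qcnj (qcnj p) = p"
  by (cases p) (simp add: qcnj_def)

lemma qcnj_sum: "qcnj (sum f S) = (\<Sum>e\<in>S. qcnj (f e))"
  by (induction S rule: infinite_finite_induct) (simp_all add: qcnj_add)

text \<open>The reals as the centre of the quaternions: by \<open>qreal_commute\<close> these are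
  scalars that move freely through noncommutative products.\<close>

definition qreal :: "real \<Rightarrow> quat" where
  "qreal t = Quat t 0 0 0"

lemma qreal_simps [simp]: "qreal 0 = 0" "qreal 1 = 1" "qcnj (qreal t) = qreal t" "qre (qreal t) = t"
  by (simp_all add: qreal_def qcnj_def quat_arith)

lemma qreal_mult: "qreal (s * t) = qreal s * qreal t"
  by (simp add: qreal_def quat_arith)

lemma qreal_add: "qreal (s + t) = qreal s + qreal t"
  by (simp add: qreal_def quat_arith)

lemma qreal_commute: "qreal t * p = p * qreal t"
  by (simp add: qreal_def quat_arith)

lemma qre_qreal_mult [simp]: "qre (qreal t * p) = t * qre p"
  by (simp add: qreal_def quat_arith)

lemma qcnj_mult_self_nonneg: "0 \<le> qre (qcnj p * p)"
  by (simp add: qcnj_def quat_arith)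

lemma qcnj_fixed_imp_qreal: "qcnj p = p \<Longrightarrow> p = qreal (qre p)"
  by (cases p) (simp add: qcnj_def qreal_def)

lemma phi_index:
  "phi p $$ (0, 0) = Complex (qre p) (qi p)"
  "phi p $$ (0, Suc 0) = Complex (qj p) (qk p)"
  "phi p $$ (Suc 0, 0) = Complex (- qj p) (qk p)"
  "phi p $$ (Suc 0, Suc 0) = Complex (qre p) (- qi p)"
  by (simp_all add: phi_def mat_of_rows_list_def)

lemma less_2_cases_nat: "(i::nat) < 2 \<Longrightarrow> i = 0 \<or> i = Suc 0"
  by auto

text \<open>That \<open>phi\<close> respects sums, products and real scalars is recorded entry by
  entry, the form in which \<open>unwrap_index\<close> presents a block.\<close>

lemma phi_zero_index: "i < 2 \<Longrightarrow> j < 2 \<Longrightarrow> phi 0 $$ (i, j) = 0"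
  by (auto dest!: less_2_cases_nat simp: phi_index complex_eq_iff)

lemma phi_one_index: "i < 2 \<Longrightarrow> j < 2 \<Longrightarrow> phi 1 $$ (i, j) = (if i = j then 1 else 0)"
  by (auto dest!: less_2_cases_nat simp: phi_index complex_eq_iff one_quat_def)

lemma phi_add_index: "i < 2 \<Longrightarrow> j < 2 \<Longrightarrow> phi (p + q) $$ (i, j) = phi p $$ (i, j) + phi q $$ (i, j)"
  by (auto dest!: less_2_cases_nat simp: phi_index complex_eq_iff)

lemma phi_mult_index:
  "i < 2 \<Longrightarrow> j < 2 \<Longrightarrow> phi (p * q) $$ (i, j) =
     phi p $$ (i, 0) * phi q $$ (0, j) + phi p $$ (i, 1) * phi q $$ (1, j)"
  by (auto dest!: less_2_cases_nat simp: phi_index complex_eq_iff times_quat_def)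

lemma phi_qreal_mult_index:
  "i < 2 \<Longrightarrow> j < 2 \<Longrightarrow> phi (qreal t * p) $$ (i, j) = of_real t * phi p $$ (i, j)"
  by (auto dest!: less_2_cases_nat simp: phi_index complex_eq_iff times_quat_def qreal_def)

lemma phi_sum_index:
  assumes "i < 2" "j < 2"
  shows "phi (sum f S) $$ (i, j) = (\<Sum>e\<in>S. phi (f e) $$ (i, j))"
  by (induction S rule: infinite_finite_induct)
     (use assms in \<open>simp_all add: phi_zero_index phi_add_index\<close>)

text \<open>Pairs the two summation indices that fall into the same block of an unwrapped
  matrix.\<close>

lemma sum_lessThan_double:
  fixes f :: "nat \<Rightarrow> 'a::comm_monoid_add"
  shows "(\<Sum>k = 0..<2 * n. f k) = (\<Sum>k = 0..<n. f (2 * k) + f (2 * k + 1))"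
  by (induction n) (simp_all add: ac_simps)

lemma half_less: "i < 2 * n \<Longrightarrow> i div 2 < (n::nat)"
  by linarith

section \<open>The unwrapping as a homomorphism, and its determinant\<close>

definition unwrap :: "quat mat \<Rightarrow> complex mat" where
  "unwrap M = z2 (map_mat phi M)"

lemma unwrap_dim [simp]:
  "dim_row (unwrap M) = 2 * dim_row M" "dim_col (unwrap M) = 2 * dim_col M"
  by (simp_all add: unwrap_def z2_def)

lemma unwrap_carrier [simp, intro]:
  "M \<in> carrier_mat n m \<Longrightarrow> unwrap M \<in> carrier_mat (2 * n) (2 * m)"
  by (auto intro!: carrier_matI)

lemma unwrap_index:
  "i < 2 * dim_row M \<Longrightarrow> j < 2 * dim_col M \<Longrightarrow>
     unwrap M $$ (i, j) = phi (M $$ (i div 2, j div 2)) $$ (i mod 2, j mod 2)"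
  by (simp add: unwrap_def z2_def)

lemma unwrap_mult:
  assumes "A \<in> carrier_mat n m" "B \<in> carrier_mat m k"
  shows "unwrap (A * B) = unwrap A * unwrap B"
  using assms
  by (intro eq_matI)
     (auto simp: unwrap_index scalar_prod_def phi_sum_index phi_mult_index sum_lessThan_double
        half_less)

lemma unwrap_add:
  assumes "A \<in> carrier_mat n m" "B \<in> carrier_mat n m"
  shows "unwrap (A + B) = unwrap A + unwrap B"
  using assms by (intro eq_matI) (auto simp: unwrap_index phi_add_index)

lemma unwrap_one: "unwrap (1\<^sub>m n) = 1\<^sub>m (2 * n)"
proof (rule eq_matI)
  fix i j assume "i < dim_row (1\<^sub>m (2 * n) :: complex mat)" "j < dim_col (1\<^sub>m (2 * n) :: complex mat)"
  moreover have "i = j \<longleftrightarrow> i div 2 = j div 2 \<and> i mod 2 = j mod 2"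
    by (metis div_mult_mod_eq)
  ultimately show "unwrap (1\<^sub>m n) $$ (i, j) = 1\<^sub>m (2 * n) $$ (i, j)"
    by (simp add: unwrap_index phi_one_index phi_zero_index half_less)
qed auto

lemma unwrap_qreal_smult: "unwrap (qreal t \<cdot>\<^sub>m M) = of_real t \<cdot>\<^sub>m unwrap M"
  by (intro eq_matI) (auto simp: unwrap_index phi_qreal_mult_index)

definition mdelta :: "quat mat \<Rightarrow> real" where
  "mdelta M = sqrt (cmod (det (unwrap M)))"

lemma delta_eq_mdelta: "delta xs ys D = mdelta (ordered_mat xs ys D)"
  by (simp add: delta_def mdelta_def unwrap_def)

lemma mdelta_mult:
  assumes "A \<in> carrier_mat n n" "B \<in> carrier_mat n n"
  shows "mdelta (A * B) = mdelta A * mdelta B"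
  using assms
  by (simp add: mdelta_def unwrap_mult det_mult[of _ "2 * n"] norm_mult real_sqrt_mult)

lemma mdelta_qreal_smult:
  assumes "M \<in> carrier_mat n n"
  shows "mdelta (qreal t \<cdot>\<^sub>m M) = \<bar>t\<bar> ^ n * mdelta M"
proof -
  \<comment> \<open>Unwrapping doubles the size, so the determinant scales by the power
    \<open>2 * n\<close>; the square root halves the exponent again.\<close>
  have "sqrt (\<bar>t\<bar> ^ (2 * n)) = \<bar>t\<bar> ^ n"
    by (simp add: power_mult mult.commute flip: real_sqrt_power)
  then show ?thesis using assms
    by (simp add: mdelta_def unwrap_qreal_smult norm_mult norm_power real_sqrt_mult)
qed

lemma mdelta_qreal_single:
  assumes "t \<ge> 0"
  shows "mdelta (mat 1 1 (\<lambda>_. qreal t)) = t"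
proof -
  have "mat 1 1 (\<lambda>_. qreal t) = qreal t \<cdot>\<^sub>m 1\<^sub>m 1"
    by (intro eq_matI) auto
  moreover have "mdelta (1\<^sub>m 1) = 1"
    by (simp add: mdelta_def unwrap_one)
  ultimately show ?thesis
    using assms by (simp add: mdelta_qreal_smult[of _ 1])
qed

text \<open>Sylvester's identity: multiplying \<open>?M\<close> from the left by the unipotent
  \<open>?U\<close> or \<open>?L\<close> clears one off-diagonal block, which gives two expressions
  for \<open>det ?M\<close>.\<close>

lemma det_one_plus_mult_swap:
  fixes P Q :: "'a::idom mat"
  assumes P: "P \<in> carrier_mat n m" and Q: "Q \<in> carrier_mat m n"
  shows "det (1\<^sub>m n + P * Q) = det (1\<^sub>m m + Q * P)"
proof -
  let ?M = "four_block_mat (1\<^sub>m n) (- P) Q (1\<^sub>m m)"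
  let ?U = "four_block_mat (1\<^sub>m n) P (0\<^sub>m m n) (1\<^sub>m m)"
  let ?L = "four_block_mat (1\<^sub>m n) (0\<^sub>m n m) (- Q) (1\<^sub>m m)"
  have c: "?M \<in> carrier_mat (n + m) (n + m)" "?U \<in> carrier_mat (n + m) (n + m)"
    "?L \<in> carrier_mat (n + m) (n + m)"
    by auto
  have "?U * ?M = four_block_mat (1\<^sub>m n + P * Q) (0\<^sub>m n m) Q (1\<^sub>m m)"
    using P Q by (subst mult_four_block_mat[of _ n n _ m _ m _ _ n _ m]) (auto intro!: cong_four_block_mat)
  moreover have "?L * ?M = four_block_mat (1\<^sub>m n) (- P) (0\<^sub>m m n) (1\<^sub>m m + Q * P)"
    using P Q by (subst mult_four_block_mat[of _ n n _ m _ m _ _ n _ m])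
      (auto intro!: cong_four_block_mat comm_add_mat)
  moreover have "det ?U = 1" "det ?L = 1"
    using P Q by (auto simp: det_four_block_mat_lower_left_zero[of _ n _ m]
        det_four_block_mat_upper_right_zero[of _ n _ m])
  ultimately show ?thesis
    using P Q det_mult[OF c(2,1)] det_mult[OF c(3,1)]
    by (simp add: det_four_block_mat_lower_left_zero[of _ n _ m]
        det_four_block_mat_upper_right_zero[of _ n _ m])
qed

text \<open>Used with \<open>m = 1\<close>, where the right-hand side concerns a single
  quaternion.\<close>

lemma mdelta_one_plus_mult_swap:
  assumes "P \<in> carrier_mat n m" "Q \<in> carrier_mat m n"
  shows "mdelta (1\<^sub>m n + P * Q) = mdelta (1\<^sub>m m + Q * P)"
  using assms det_one_plus_mult_swap[of "unwrap P" "2 * n" "2 * m" "unwrap Q"]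
  by (simp add: mdelta_def unwrap_add[of _ n n] unwrap_add[of _ m m] unwrap_mult[of _ n m]
      unwrap_mult[of _ m n] unwrap_one)

section \<open>Rank one updates of positive definite matrices\<close>

definition adj :: "quat mat \<Rightarrow> quat mat" where
  "adj M = mat (dim_col M) (dim_row M) (\<lambda>(i, j). qcnj (M $$ (j, i)))"

lemma adj_dim [simp]: "dim_row (adj M) = dim_col M" "dim_col (adj M) = dim_row M"
  by (simp_all add: adj_def)

lemma adj_carrier [simp]: "M \<in> carrier_mat n m \<Longrightarrow> adj M \<in> carrier_mat m n"
  by (auto intro!: carrier_matI)

lemma adj_index [simp]: "i < dim_col M \<Longrightarrow> j < dim_row M \<Longrightarrow> adj M $$ (i, j) = qcnj (M $$ (j, i))"
  by (simp add: adj_def)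

lemma adj_adj [simp]: "adj (adj M) = M"
  by (intro eq_matI) auto

lemma adj_add:
  assumes "A \<in> carrier_mat n m" "B \<in> carrier_mat n m"
  shows "adj (A + B) = adj A + adj B"
  using assms by (intro eq_matI) (auto simp: qcnj_add)

lemma adj_one [simp]: "adj (1\<^sub>m n) = 1\<^sub>m n"
  by (intro eq_matI) (auto simp: qcnj_def quat_arith)

lemma adj_mult:
  assumes "A \<in> carrier_mat n m" "B \<in> carrier_mat m k"
  shows "adj (A * B) = adj B * adj A"
  using assms by (intro eq_matI) (auto simp: scalar_prod_def qcnj_sum qcnj_mult)

lemma qre_adj_mult_self_nonneg:
  assumes "a \<in> carrier_mat n 1"
  shows "0 \<le> qre ((adj a * a) $$ (0, 0))"
  using assms by (auto simp: scalar_prod_def quat_sum_simps intro!: sum_nonneg qcnj_mult_self_nonneg)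

text \<open>Positive definiteness, expressed as Hermitian, positive semidefinite and invertible,
  because rank one updates compute with the inverse. For Hermitian \<open>M\<close> the quaternion
  under \<open>qre\<close> is real.\<close>

definition pos_inv :: "nat \<Rightarrow> quat mat \<Rightarrow> bool" where
  "pos_inv n M \<longleftrightarrow> M \<in> carrier_mat n n \<and> adj M = M \<and>
     (\<forall>x\<in>carrier_mat n 1. 0 \<le> qre ((adj x * (M * x)) $$ (0, 0))) \<and>
     (\<exists>N\<in>carrier_mat n n. M * N = 1\<^sub>m n \<and> N * M = 1\<^sub>m n)"

section \<open>Scalars in products of quaternion matrices\<close>

lemma smult_mult_mat:
  fixes A B :: "'a::semiring_0 mat"
  assumes "A \<in> carrier_mat n m" "B \<in> carrier_mat m k"
  shows "(c \<cdot>\<^sub>m A) * B = c \<cdot>\<^sub>m (A * B)"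
  using assms by (intro eq_matI) (auto simp: scalar_prod_def sum_distrib_left mult.assoc)

lemma smult_smult_mat:
  fixes A :: "'a::semigroup_mult mat"
  shows "c \<cdot>\<^sub>m (d \<cdot>\<^sub>m A) = (c * d) \<cdot>\<^sub>m A"
  by (intro eq_matI) (auto simp: mult.assoc)

lemma mult_qreal_smult:
  assumes "A \<in> carrier_mat n m" "B \<in> carrier_mat m k"
  shows "A * (qreal t \<cdot>\<^sub>m B) = qreal t \<cdot>\<^sub>m (A * B)"
proof -
  have "p * (qreal t * q) = qreal t * (p * q)" for p q
    by (metis mult.assoc qreal_commute)
  then show ?thesis
    using assms by (intro eq_matI) (auto simp: scalar_prod_def sum_distrib_left)
qed

lemma adj_qreal_smult: "adj (qreal t \<cdot>\<^sub>m A) = qreal t \<cdot>\<^sub>m adj A"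
  by (intro eq_matI) (auto simp: qcnj_mult qreal_commute)

text \<open>With \<open>u = N * b\<close> and \<open>v = w * N\<close>, the inverse of
  \<open>M + b * w\<close> is \<open>N - u * (K * v)\<close>, where \<open>K\<close> is the inverse
  of \<open>1 + d\<close>; \<open>d \<ge> 0\<close> keeps \<open>1 + d\<close> nonzero.\<close>

lemma sherman_morrison:
  assumes M: "M \<in> carrier_mat n n" and N: "N \<in> carrier_mat n n"
    and MN: "M * N = 1\<^sub>m n" and NM: "N * M = 1\<^sub>m n"
    and b: "b \<in> carrier_mat n 1" and w: "w \<in> carrier_mat 1 n"
    and wNb: "w * (N * b) = mat 1 1 (\<lambda>_. qreal d)" and d: "d \<ge> 0"
  shows "\<exists>N'\<in>carrier_mat n n. (M + b * w) * N' = 1\<^sub>m n \<and> N' * (M + b * w) = 1\<^sub>m n"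
    and "mdelta (M + b * w) = mdelta M * (1 + d)"
proof -
  note [simp del] = assoc_mult_mat index_mult_mat(1) One_nat_def
  define D where "D = mat 1 1 (\<lambda>_. qreal d)"
  define K where "K = mat 1 1 (\<lambda>_. qreal (1 / (1 + d)))"
  define u where "u = N * b"
  define v where "v = w * N"
  have car: "u \<in> carrier_mat n 1" "v \<in> carrier_mat 1 n"
    "K \<in> carrier_mat 1 1" "D \<in> carrier_mat 1 1"
    using N b w by (auto simp: K_def D_def u_def v_def)
  have "d + 1 \<noteq> 0" using d by linarith
  then have 1: "d / (1 + d) = 1 - 1 / (1 + d)" by (simp add: field_simps)
  \<comment> \<open>As \<open>K\<close> inverts \<open>1 + D\<close>, these identities turn the
    mixed products below into differences that cancel.\<close>
  have DK: "D * K = 1\<^sub>m 1 - K" "K * D = 1\<^sub>m 1 - K"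
    unfolding D_def K_def
    by (intro eq_matI; auto simp: index_mult_mat(1) scalar_prod_def qreal_def quat_arith 1)+
  have wu: "w * u = D" using wNb by (simp add: D_def u_def)
  have vb: "v * b = D" using w N b wu unfolding v_def u_def by (simp add: assoc_mult_mat[of w 1 n N n b 1])
  have Mu: "M * u = b" unfolding u_def using M N b MN by (simp flip: assoc_mult_mat[of M n n N n b 1])
  have vM: "v * M = w" unfolding v_def using M N w NM by (simp add: assoc_mult_mat[of w 1 n N n M n])
  have bw: "b * w \<in> carrier_mat n n" using b w by simp
  have Kv: "K * v \<in> carrier_mat 1 n" using car by simp
  have uKv: "u * (K * v) \<in> carrier_mat n n" using car(1) Kv by simp
  have Kw: "K * w \<in> carrier_mat 1 n" using car w by simp
  have "(M + b * w) * (N - u * (K * v)) = 1\<^sub>m n"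
  proof -
    have "(M + b * w) * (N - u * (K * v)) =
        (M * N + b * w * N) - (M * (u * (K * v)) + b * w * (u * (K * v)))"
      using M N bw uKv
      by (simp add: mult_minus_distrib_mat[of _ n n _ n] add_mult_distrib_mat[of _ n n _ _ n])
    also have "M * (u * (K * v)) = b * (K * v)"
      using assoc_mult_mat[OF M car(1) Kv] Mu by simp
    also have "b * w * (u * (K * v)) = b * (D * (K * v))"
      using assoc_mult_mat[OF b w uKv] assoc_mult_mat[OF w car(1) Kv] wu by simp
    also have "D * (K * v) = v - K * v"
      using assoc_mult_mat[OF car(4) car(3) car(2)] minus_mult_distrib_mat[OF one_carrier_mat car(3) car(2)] car
      by (simp add: DK)
    also have "b * (v - K * v) = b * v - b * (K * v)"
      by (rule mult_minus_distrib_mat[OF b car(2) Kv])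
    also have "b * w * N = b * v"
      unfolding v_def by (rule assoc_mult_mat[OF b w N])
    finally show ?thesis
      using MN b car Kv by (auto intro!: eq_matI)
  qed
  moreover have "(N - u * (K * v)) * (M + b * w) = 1\<^sub>m n"
  proof -
    have "(N - u * (K * v)) * (M + b * w) =
        N * (M + b * w) - u * (K * v) * (M + b * w)"
      using M bw by (intro minus_mult_distrib_mat[OF N uKv, of _ n]) simp
    also have "N * (M + b * w) = 1\<^sub>m n + u * w"
      using mult_add_distrib_mat[OF N M bw] NM assoc_mult_mat[OF N b w] by (simp add: u_def)
    also have "u * (K * v) * (M + b * w) = u * (K * v) * M + u * (K * v) * (b * w)"
      by (rule mult_add_distrib_mat[OF uKv M bw])
    also have "u * (K * v) * M = u * (K * w)"
      using assoc_mult_mat[OF car(1) Kv M] assoc_mult_mat[OF car(3) car(2) M] vM by simp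
    also have "u * (K * v) * (b * w) = u * (K * (D * w))"
      using assoc_mult_mat[OF car(1) Kv bw] assoc_mult_mat[OF car(3) car(2) bw]
        assoc_mult_mat[OF car(2) b w] vb by simp
    also have "K * (D * w) = w - K * w"
      using assoc_mult_mat[OF car(3) car(4) w] minus_mult_distrib_mat[OF one_carrier_mat car(3) w] w
      by (simp add: DK)
    also have "u * (w - K * w) = u * w - u * (K * w)"
      by (rule mult_minus_distrib_mat[OF car(1) w Kw])
    finally show ?thesis
      using w car Kw by (auto intro!: eq_matI)
  qed
  moreover have "N - u * (K * v) \<in> carrier_mat n n"
    using N uKv by (simp add: minus_carrier_mat)
  ultimately show "\<exists>N'\<in>carrier_mat n n. (M + b * w) * N' = 1\<^sub>m n \<and> N' * (M + b * w) = 1\<^sub>m n"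
    by blast
  have uw: "u * w \<in> carrier_mat n n" using car w by simp
  \<comment> \<open>\<open>M * u = b\<close> lets \<open>M\<close> be factored out; swapping
    \<open>u\<close> and \<open>w\<close> then leaves the \<open>1 \<times> 1\<close> matrix
    \<open>1 + d\<close>.\<close>
  have "M + b * w = M * (1\<^sub>m n + u * w)"
    using mult_add_distrib_mat[OF M one_carrier_mat uw] assoc_mult_mat[OF M car(1) w] M Mu by simp
  moreover have "1\<^sub>m 1 + w * u = mat 1 1 (\<lambda>_. qreal (1 + d))"
    unfolding wu D_def by (intro eq_matI) (auto simp: qreal_add)
  ultimately show "mdelta (M + b * w) = mdelta M * (1 + d)"
    using mdelta_mult[of M n "1\<^sub>m n + u * w"] mdelta_one_plus_mult_swap[OF car(1) w]
      mdelta_qreal_single[of "1 + d"] M uw d by simp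
qed

text \<open>The constant is the real number \<open>adj a * N * a\<close> for the inverse
  \<open>N\<close> of \<open>M\<close>, so one \<open>c\<close> serves all \<open>t\<close>.\<close>

lemma pos_inv_rank_one_update:
  assumes "pos_inv n M" and a: "a \<in> carrier_mat n 1"
  obtains c where "\<And>t. t \<ge> 0 \<Longrightarrow> pos_inv n (M + qreal t \<cdot>\<^sub>m (a * adj a))"
    and "\<And>t. t \<ge> 0 \<Longrightarrow> mdelta (M + qreal t \<cdot>\<^sub>m (a * adj a)) = mdelta M * (1 + t * c)"
proof -
  note [simp del] = assoc_mult_mat index_mult_mat(1) One_nat_def
  from assms(1) obtain N where M: "M \<in> carrier_mat n n" "adj M = M"
    and psd: "\<And>x. x \<in> carrier_mat n 1 \<Longrightarrow> 0 \<le> qre ((adj x * (M * x)) $$ (0, 0))"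
    and N: "N \<in> carrier_mat n n" "M * N = 1\<^sub>m n" "N * M = 1\<^sub>m n"
    unfolding pos_inv_def by blast
  \<comment> \<open>The adjoint of \<open>N\<close> is a left inverse of the Hermitian
    \<open>M\<close>, hence equal to \<open>N\<close>.\<close>
  have adjN: "adj N = N"
  proof -
    have 1: "adj N * M = 1\<^sub>m n" using adj_mult[OF M(1) N(1)] M N by simp
    have "adj N = adj N * (M * N)" using N by simp
    also have "\<dots> = (adj N * M) * N"
      using M N by (simp add: assoc_mult_mat[of _ n n _ n _ n])
    also have "\<dots> = N" using 1 N by simp
    finally show ?thesis .
  qed
  define c where "c = qre ((adj a * (N * a)) $$ (0, 0))"
  have Na: "N * a \<in> carrier_mat n 1" using N a by simp
  \<comment> \<open>Substituting \<open>N * a\<close> into the quadratic form of \<open>M\<close>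
    yields \<open>c\<close>.\<close>
  have "c \<ge> 0"
  proof -
    have "M * (N * a) = a" using M N a by (simp flip: assoc_mult_mat[of M n n N n a 1])
    moreover have "adj (N * a) = adj a * N" using N a adjN by (simp add: adj_mult)
    ultimately have "adj (N * a) * (M * (N * a)) = adj a * (N * a)"
      using N a by (simp add: assoc_mult_mat[of "adj a" 1 n N n a 1])
    then show ?thesis unfolding c_def using psd[OF Na] by simp
  qed
  have C: "adj a * (N * a) = mat 1 1 (\<lambda>_. qreal c)"
  proof -
    have "adj (adj a * (N * a)) = adj a * (N * a)"
      using N a Na adjN adj_mult[of "adj a" 1 n "N * a" 1] adj_mult[OF N(1) a]
      by (simp add: assoc_mult_mat[of _ 1 n _ n _ 1])
    then have "qcnj ((adj a * (N * a)) $$ (0, 0)) = (adj a * (N * a)) $$ (0, 0)"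
      using a adj_index[of 0 "adj a * (N * a)" 0] by auto
    from qcnj_fixed_imp_qreal[OF this] show ?thesis
      using a unfolding c_def by (intro eq_matI) auto
  qed
  \<comment> \<open>The update with weight 1 for any column \<open>b\<close> of this kind; the
    weight \<open>t\<close> enters later by taking \<open>b\<close> as \<open>sqrt t\<close> times
    \<open>a\<close>.\<close>
  have *: "pos_inv n (M + b * adj b) \<and> mdelta (M + b * adj b) = mdelta M * (1 + d)"
    if b: "b \<in> carrier_mat n 1" and D: "adj b * (N * b) = mat 1 1 (\<lambda>_. qreal d)" and d: "d \<ge> 0" for b d
  proof -
    let ?M' = "M + b * adj b"
    have car: "adj b \<in> carrier_mat 1 n" "?M' \<in> carrier_mat n n" using b M by auto
    note sm = sherman_morrison[OF M(1) N b car(1) D d]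
    have "adj ?M' = ?M'"
      using M b adj_mult[OF b car(1)] by (simp add: adj_add[of _ n n])
    moreover have "0 \<le> qre ((adj x * (?M' * x)) $$ (0, 0))" if x: "x \<in> carrier_mat n 1" for x
    proof -
      \<comment> \<open>The new term of the quadratic form is \<open>adj y * y\<close> for
        \<open>y = adj b * x\<close>.\<close>
      have y: "adj b * x \<in> carrier_mat 1 1" by (rule mult_carrier_mat[OF car(1) x])
      have "adj x * (?M' * x) = adj x * (M * x + b * adj b * x)"
        using add_mult_distrib_mat[of M n n "b * adj b" x 1] M b x by simp
      also have "\<dots> = adj x * (M * x) + adj x * (b * adj b * x)"
        using b M x by (intro mult_add_distrib_mat[of _ 1 n _ 1]) auto
      also have "b * adj b * x = b * (adj b * x)"
        by (rule assoc_mult_mat[OF b car(1) x])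
      also have "adj x * (b * (adj b * x)) = (adj x * b) * (adj b * x)"
        using b x by (intro assoc_mult_mat[symmetric, of _ 1 n _ 1 _ 1]) auto
      also have "adj x * b = adj (adj b * x)"
        using adj_mult[OF car(1) x] by simp
      finally show ?thesis
        using psd[OF x] qre_adj_mult_self_nonneg[OF y] x b by simp
    qed
    ultimately show ?thesis
      using sm car unfolding pos_inv_def by blast
  qed
  have **: "pos_inv n (M + qreal t \<cdot>\<^sub>m (a * adj a)) \<and>
      mdelta (M + qreal t \<cdot>\<^sub>m (a * adj a)) = mdelta M * (1 + t * c)" if t: "t \<ge> 0" for t
  proof -
    define b where "b = qreal (sqrt t) \<cdot>\<^sub>m a"
    have b: "b \<in> carrier_mat n 1" using a by (simp add: b_def)
    have tt: "qreal (sqrt t) * qreal (sqrt t) = qreal t"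
      using t by (simp flip: qreal_mult)
    have adjb: "adj b = qreal (sqrt t) \<cdot>\<^sub>m adj a"
      unfolding b_def by (rule adj_qreal_smult)
    have "b * adj b = qreal t \<cdot>\<^sub>m (a * adj a)"
      unfolding adjb unfolding b_def using a adj_carrier[OF a]
      by (simp add: smult_mult_mat[of _ n 1 _ n] mult_qreal_smult[of _ n 1 _ n] smult_smult_mat tt)
    moreover have "adj b * (N * b) = mat 1 1 (\<lambda>_. qreal (t * c))"
    proof -
      have "N * b = qreal (sqrt t) \<cdot>\<^sub>m (N * a)"
        unfolding b_def by (rule mult_qreal_smult[OF N(1) a])
      then have "adj b * (N * b) = qreal t \<cdot>\<^sub>m (adj a * (N * a))"
        unfolding adjb using adj_carrier[OF a] Na
        by (simp add: smult_mult_mat[of _ 1 n _ 1] mult_qreal_smult[of _ 1 n _ 1] smult_smult_mat tt)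
      then show ?thesis unfolding C by (simp add: qreal_mult) (intro eq_matI; auto)
    qed
    ultimately show ?thesis
      using *[OF b, of "t * c"] t \<open>c \<ge> 0\<close> by simp
  qed
  then show ?thesis using that by blast
qed

lemma pos_inv_qreal_smult_one:
  assumes "\<epsilon> > 0"
  shows "pos_inv n (qreal \<epsilon> \<cdot>\<^sub>m 1\<^sub>m n)"
proof -
  have smult_mult: "qreal s \<cdot>\<^sub>m 1\<^sub>m n * B = qreal s \<cdot>\<^sub>m B" if "B \<in> carrier_mat n m" for s B m
    using smult_mult_mat[OF one_carrier_mat that] that by simp
  have inv: "qreal s \<cdot>\<^sub>m 1\<^sub>m n * (qreal t \<cdot>\<^sub>m 1\<^sub>m n) = 1\<^sub>m n" if "s * t = 1" for s t
    using that by (subst smult_mult[of _ n]) (auto intro!: eq_matI simp flip: qreal_mult)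
  have "0 \<le> qre ((adj x * (qreal \<epsilon> \<cdot>\<^sub>m 1\<^sub>m n * x)) $$ (0, 0))" if x: "x \<in> carrier_mat n 1" for x
  proof -
    have "adj x * (qreal \<epsilon> \<cdot>\<^sub>m x) = qreal \<epsilon> \<cdot>\<^sub>m (adj x * x)"
      by (rule mult_qreal_smult[OF adj_carrier[OF x] x])
    then show ?thesis
      using qre_adj_mult_self_nonneg[OF x] x assms by (simp add: smult_mult del: index_mult_mat(1))
  qed
  moreover have "adj (qreal \<epsilon> \<cdot>\<^sub>m 1\<^sub>m n) = qreal \<epsilon> \<cdot>\<^sub>m 1\<^sub>m n"
    by (intro eq_matI) auto
  ultimately show ?thesis
    using assms inv[of \<epsilon> "1 / \<epsilon>"] inv[of "1 / \<epsilon>" \<epsilon>] unfolding pos_inv_def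
    by (auto intro!: bexI[of _ "qreal (1 / \<epsilon>) \<cdot>\<^sub>m 1\<^sub>m n"])
qed

section \<open>Weighted sums of rank one matrices\<close>

text \<open>With \<open>a e\<close> as column \<open>e\<close> of a matrix \<open>A\<close>, this is
  \<open>A W A\<^sup>\<dagger>\<close> for the diagonal matrix \<open>W\<close> of the
  weights.\<close>

definition gram :: "nat \<Rightarrow> 'e set \<Rightarrow> ('e \<Rightarrow> nat \<Rightarrow> quat) \<Rightarrow> ('e \<Rightarrow> real) \<Rightarrow> quat mat" where
  "gram n S a w = mat n n (\<lambda>(i, j). \<Sum>e\<in>S. qreal (w e) * (a e i * qcnj (a e j)))"

lemma gram_carrier [simp]: "gram n S a w \<in> carrier_mat n n"
  by (simp add: gram_def)

lemma gram_cong: "(\<And>e. e \<in> S \<Longrightarrow> w e = w' e) \<Longrightarrow> gram n S a w = gram n S a w'"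
  unfolding gram_def by (intro eq_matI) (auto intro!: sum.cong)

lemma gram_scale: "gram n S a (\<lambda>e. t * w e) = qreal t \<cdot>\<^sub>m gram n S a w"
  unfolding gram_def by (intro eq_matI) (auto simp: qreal_mult mult.assoc sum_distrib_left)

lemma gram_insert:
  assumes "finite S" "e \<notin> S"
  shows "gram n (insert e S) a w = gram n S a w +
    qreal (w e) \<cdot>\<^sub>m (mat n 1 (\<lambda>(i, _). a e i) * adj (mat n 1 (\<lambda>(i, _). a e i)))"
  using assms unfolding gram_def by (intro eq_matI) (auto simp: scalar_prod_def add.commute)

text \<open>The shift provides an invertible start, and each column is a rank one update of
  it.\<close>

lemma pos_inv_gram:
  assumes "finite S" "\<epsilon> > 0" "\<And>e. 0 \<le> w e"
  shows "pos_inv n (qreal \<epsilon> \<cdot>\<^sub>m 1\<^sub>m n + gram n S a w)"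
  using assms(1)
proof (induction S rule: finite_induct)
  case empty
  have "qreal \<epsilon> \<cdot>\<^sub>m 1\<^sub>m n + gram n {} a w = qreal \<epsilon> \<cdot>\<^sub>m 1\<^sub>m n"
    by (intro eq_matI) (auto simp: gram_def)
  with pos_inv_qreal_smult_one[OF assms(2)] show ?case by simp
next
  case (insert e S)
  let ?a = "mat n 1 (\<lambda>(i, _). a e i)"
  have a: "?a \<in> carrier_mat n 1" by simp
  have "qreal \<epsilon> \<cdot>\<^sub>m 1\<^sub>m n + gram n (insert e S) a w =
      qreal \<epsilon> \<cdot>\<^sub>m 1\<^sub>m n + gram n S a w + qreal (w e) \<cdot>\<^sub>m (?a * adj ?a)"
    unfolding gram_insert[OF insert.hyps]
    by (rule assoc_add_mat[symmetric, of _ n n]) auto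
  with pos_inv_rank_one_update[OF insert.IH a] assms(3) show ?case by metis
qed

text \<open>The term of \<open>e\<close> is a rank one update of the rest. Interpolating between 0
  and 1 avoids the constant \<open>c\<close>, which depends on \<open>\<epsilon>\<close> and may
  diverge as \<open>\<epsilon>\<close> tends to 0.\<close>

lemma mdelta_shifted_gram_affine:
  fixes a :: "'e \<Rightarrow> nat \<Rightarrow> quat" and n :: nat
  assumes "finite S" "e \<in> S" "\<epsilon> > 0" "\<And>e. 0 \<le> w e" "0 \<le> t"
  defines "f \<equiv> \<lambda>t. mdelta (qreal \<epsilon> \<cdot>\<^sub>m 1\<^sub>m n + gram n S a (w(e := t)))"
  shows "f t = (1 - t) * f 0 + t * f 1"
proof -
  let ?a = "mat n 1 (\<lambda>(i, _). a e i)"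
  let ?M = "qreal \<epsilon> \<cdot>\<^sub>m 1\<^sub>m n + gram n (S - {e}) a w"
  have a: "?a \<in> carrier_mat n 1" by simp
  have "pos_inv n ?M"
    using assms by (intro pos_inv_gram) auto
  from pos_inv_rank_one_update[OF this a] obtain c where c: "mdelta (?M + qreal s \<cdot>\<^sub>m (?a * adj ?a)) = mdelta ?M * (1 + s * c)"
    if "s \<ge> 0" for s
    by metis
  have "f s = mdelta ?M * (1 + s * c)" if "s \<ge> 0" for s
  proof -
    have "gram n S a (w(e := s)) = gram n (S - {e}) a (w(e := s)) + qreal s \<cdot>\<^sub>m (?a * adj ?a)"
      using gram_insert[of "S - {e}" e n a "w(e := s)"] assms by (simp add: insert_absorb)
    also have "gram n (S - {e}) a (w(e := s)) = gram n (S - {e}) a w"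
      by (rule gram_cong) simp
    finally have gram_eq: "gram n S a (w(e := s)) =
      gram n (S - {e}) a w + qreal s \<cdot>\<^sub>m (?a * adj ?a)" .
    have "qreal \<epsilon> \<cdot>\<^sub>m 1\<^sub>m n + gram n S a (w(e := s)) = ?M + qreal s \<cdot>\<^sub>m (?a * adj ?a)"
      unfolding gram_eq by (rule assoc_add_mat[symmetric, of _ n n]) auto
    then show ?thesis using c[OF that] by (simp add: f_def)
  qed
  then show ?thesis using \<open>0 \<le> t\<close> by (simp add: algebra_simps)
qed

section \<open>Passing to the limit of vanishing shift\<close>

lemma tendsto_det:
  fixes F :: "'b \<Rightarrow> 'a::real_normed_field mat"
  assumes "\<And>x. F x \<in> carrier_mat n n" "L \<in> carrier_mat n n"
    and "\<And>i j. i < n \<Longrightarrow> j < n \<Longrightarrow> ((\<lambda>x. F x $$ (i, j)) \<longlongrightarrow> L $$ (i, j)) net"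
  shows "((\<lambda>x. det (F x)) \<longlongrightarrow> det L) net"
  unfolding det_def'[OF assms(1)] det_def'[OF assms(2)]
  by (intro tendsto_sum tendsto_mult tendsto_const tendsto_prod assms(3))
     (auto dest: permutes_in_image)

lemma tendsto_mdelta_shift:
  assumes "M \<in> carrier_mat n n"
  shows "((\<lambda>\<epsilon>. mdelta (qreal \<epsilon> \<cdot>\<^sub>m 1\<^sub>m n + M)) \<longlongrightarrow> mdelta M) (at_right 0)"
proof -
  have "((\<lambda>\<epsilon>. det (unwrap (qreal \<epsilon> \<cdot>\<^sub>m 1\<^sub>m n + M))) \<longlongrightarrow> det (unwrap M)) (at_right 0)"
    using assms
    by (intro tendsto_det[of _ "2 * n"])
       (auto simp: unwrap_add[of _ n n] unwrap_qreal_smult unwrap_one intro!: tendsto_eq_intros)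
  then show ?thesis
    unfolding mdelta_def by (intro tendsto_intros)
qed

lemma mdelta_gram_affine:
  fixes a :: "'e \<Rightarrow> nat \<Rightarrow> quat" and n :: nat
  assumes "finite S" "e \<in> S" "\<And>e. 0 \<le> w e" "0 \<le> t"
  defines "f \<equiv> \<lambda>t. mdelta (gram n S a (w(e := t)))"
  shows "f t = (1 - t) * f 0 + t * f 1"
proof -
  define g where "g \<epsilon> t = mdelta (qreal \<epsilon> \<cdot>\<^sub>m 1\<^sub>m n + gram n S a (w(e := t)))" for \<epsilon> t
  have lim: "((\<lambda>\<epsilon>. g \<epsilon> s) \<longlongrightarrow> f s) (at_right 0)" for s
    unfolding g_def f_def by (rule tendsto_mdelta_shift) simp
  have "((\<lambda>\<epsilon>. (1 - t) * g \<epsilon> 0 + t * g \<epsilon> 1) \<longlongrightarrow> (1 - t) * f 0 + t * f 1) (at_right 0)"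
    by (intro tendsto_intros lim)
  \<comment> \<open>Positive definiteness requires \<open>\<epsilon> > 0\<close>, hence the
    one-sided limit.\<close>
  moreover have "\<forall>\<^sub>F \<epsilon> in at_right 0. (1 - t) * g \<epsilon> 0 + t * g \<epsilon> 1 = g \<epsilon> t"
    using eventually_at_right_less[of 0] by eventually_elim
      (use assms mdelta_shifted_gram_affine[of S e _ w t n a] in \<open>simp add: g_def\<close>)
  ultimately have "((\<lambda>\<epsilon>. g \<epsilon> t) \<longlongrightarrow> (1 - t) * f 0 + t * f 1) (at_right 0)"
    by (simp add: tendsto_cong)
  then show ?thesis
    using tendsto_unique[OF _ lim] by simp
qed

section \<open>Homogeneous functions that are affine in each variable\<close>

text \<open>Interpolate one variable after another; \<open>B\<close> collects the variables set to
  1. The values \<open>w\<close> outside \<open>F\<close> stay arbitrary because the induction fixes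
  them at 0 or 1.\<close>

lemma multi_affine_expansion:
  fixes h :: "('e \<Rightarrow> real) \<Rightarrow> real"
  assumes "finite F" "0 \<le> l" "\<And>e. 0 \<le> w e"
    and "\<And>w e t. e \<in> F \<Longrightarrow> (\<And>e. 0 \<le> w e) \<Longrightarrow> 0 \<le> t \<Longrightarrow>
      h (w(e := t)) = (1 - t) * h (w(e := 0)) + t * h (w(e := 1))"
  shows "h (\<lambda>e. if e \<in> F then l else w e) =
    (\<Sum>B\<in>Pow F. l ^ card B * (1 - l) ^ (card F - card B) *
       h (\<lambda>e. if e \<in> B then 1 else if e \<in> F then 0 else w e))"
  using assms(1,3,4)
proof (induction F arbitrary: w rule: finite_induct)
  case empty
  then show ?case by simp
next
  case (insert a F)
  let ?v = "\<lambda>e. if e \<in> F then l else w e"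
  let ?g = "\<lambda>F w B. h (\<lambda>e. if e \<in> B then 1 else if e \<in> F then 0 else w e)"
  let ?c = "\<lambda>B. l ^ card B * (1 - l) ^ (card F - card B)"
  let ?d = "\<lambda>B. l ^ card B * (1 - l) ^ (card (insert a F) - card B)"
  have IH: "h (?v(a := s)) = (\<Sum>B\<in>Pow F. ?c B * ?g F (w(a := s)) B)" if "s \<ge> 0" for s
  proof -
    have "h (?v(a := s)) = h (\<lambda>e. if e \<in> F then l else (w(a := s)) e)"
      using insert.hyps by (intro arg_cong[of _ _ h]) auto
    also have "\<dots> = (\<Sum>B\<in>Pow F. ?c B * ?g F (w(a := s)) B)"
    proof (rule insert.IH)
      show "0 \<le> (w(a := s)) e" for e using that insert.prems(1) by simp
      show "h (w'(e := t)) = (1 - t) * h (w'(e := 0)) + t * h (w'(e := 1))"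
        if "e \<in> F" "\<And>e. 0 \<le> w' e" "0 \<le> t" for w' e t
        using that by (intro insert.prems(2)) blast+
    qed
    finally show ?thesis .
  qed
  have "h (\<lambda>e. if e \<in> insert a F then l else w e) = h (?v(a := l))"
    by (rule arg_cong[of _ _ h]) auto
  also have "\<dots> = (1 - l) * h (?v(a := 0)) + l * h (?v(a := 1))"
    using insert.prems(1) assms(2) by (intro insert.prems(2)) auto
  \<comment> \<open>Subsets of \<open>insert a F\<close> that omit \<open>a\<close>.\<close>
  also have "(1 - l) * h (?v(a := 0)) = (\<Sum>B\<in>Pow F. ?d B * ?g (insert a F) w B)"
  proof -
    have step: "(1 - l) * (?c B * ?g F (w(a := 0)) B) = ?d B * ?g (insert a F) w B" if "B \<in> Pow F" for B
    proof -
      \<comment> \<open>This bound makes the truncated subtraction in the exponent grow by exactly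
        one.\<close>
      have "card B \<le> card F" using that insert.hyps by (auto intro: card_mono)
      then have d: "?d B = (1 - l) * ?c B" using insert.hyps by (simp add: Suc_diff_le)
      have g: "?g F (w(a := 0)) B = ?g (insert a F) w B"
        using that insert.hyps by (intro arg_cong[of _ _ h]) auto
      show ?thesis unfolding d g by (rule mult.assoc[symmetric])
    qed
    show ?thesis
      unfolding IH[OF order_refl] sum_distrib_left by (intro sum.cong refl step)
  qed
  \<comment> \<open>Subsets that contain \<open>a\<close>, reindexed by removing
    \<open>a\<close>.\<close>
  also have "l * h (?v(a := 1)) = (\<Sum>B\<in>insert a ` Pow F. ?d B * ?g (insert a F) w B)"
  proof -
    have inj: "inj_on (insert a) (Pow F)"
      using insert.hyps(2) by (intro inj_onI) (metis Pow_iff insert_ident subsetD)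
    have step: "l * (?c B * ?g F (w(a := 1)) B) = ?d (insert a B) * ?g (insert a F) w (insert a B)"
      if "B \<in> Pow F" for B
    proof -
      have "finite B" "a \<notin> B" using that insert.hyps by (auto intro: finite_subset)
      then have d: "?d (insert a B) = l * ?c B" using insert.hyps by simp
      have g: "?g F (w(a := 1)) B = ?g (insert a F) w (insert a B)"
        using that insert.hyps by (intro arg_cong[of _ _ h]) auto
      show ?thesis unfolding d g by (rule mult.assoc[symmetric])
    qed
    show ?thesis
      unfolding IH[OF zero_le_one] sum_distrib_left sum.reindex[OF inj] o_def
      by (intro sum.cong refl step)
  qed
  finally show ?case
    unfolding Pow_insert using insert.hyps
    by (subst sum.union_disjoint) auto
qed

text \<open>The expansion is assumed for all \<open>F \<subseteq> E\<close>, since the vanishing of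
  \<open>g F\<close> for small \<open>F\<close> comes from the expansion of \<open>g F\<close>
  itself.\<close>

lemma homogeneous_expansion_sum:
  fixes g :: "'e set \<Rightarrow> real"
  assumes "finite E"
    and hom: "\<And>F l. F \<subseteq> E \<Longrightarrow> 0 \<le> l \<Longrightarrow>
      l ^ r * g F = (\<Sum>B\<in>Pow F. l ^ card B * (1 - l) ^ (card F - card B) * g B)"
  shows "g E = (\<Sum>B | B \<subseteq> E \<and> card B = r. g B)"
proof -
  have zero: "g F = 0" if "F \<subseteq> E" "card F < r" for F
    using that
  proof (induction "card F" arbitrary: F rule: less_induct)
    case less
    have fin: "finite F" using less.prems assms(1) by (auto intro: finite_subset)
    \<comment> \<open>Proper subsets vanish by induction, leaving only \<open>B = F\<close>; at
      \<open>l = 1/2\<close> the powers \<open>l ^ r\<close> and \<open>l ^ card F\<close>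
      differ.\<close>
    have "(1 / 2) ^ r * g F = (\<Sum>B\<in>Pow F. (1 / 2) ^ card B * (1 - 1 / 2) ^ (card F - card B) * g B)"
      using less.prems by (intro hom) auto
    also have "\<dots> = (\<Sum>B\<in>{F}. (1 / 2) ^ card B * (1 - 1 / 2) ^ (card F - card B) * g B)"
    proof (rule sum.mono_neutral_right)
      show "\<forall>B\<in>Pow F - {F}. (1 / 2) ^ card B * (1 - 1 / 2) ^ (card F - card B) * g B = 0"
        using less.hyps less.prems fin by (auto intro!: psubset_card_mono less_trans[OF psubset_card_mono])
    qed (use fin in auto)
    finally have "((1 / 2) ^ r - (1 / 2) ^ card F) * g F = 0" by (simp add: algebra_simps)
    moreover have "(1 / 2 :: real) ^ r < (1 / 2) ^ card F"
      using less.prems by (intro power_strict_decreasing) auto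
    ultimately show ?case by simp
  qed
  \<comment> \<open>The summand divided by \<open>l ^ r\<close>. Sets smaller than \<open>r\<close>,
    where the natural subtraction would truncate, get 0 because \<open>g\<close> vanishes
    there.\<close>
  let ?t = "\<lambda>l B. if card B < r then 0 else l ^ (card B - r) * (1 - l) ^ (card E - card B) * g B"
  have eq: "(\<Sum>B\<in>Pow E. ?t l B) = g E" if "l > 0" for l
  proof -
    have "l ^ r * (\<Sum>B\<in>Pow E. ?t l B) = (\<Sum>B\<in>Pow E. l ^ card B * (1 - l) ^ (card E - card B) * g B)"
      unfolding sum_distrib_left
      by (rule sum.cong) (auto simp: zero simp flip: power_add mult.assoc)
    also have "\<dots> = l ^ r * g E" using that by (intro hom[symmetric]) auto
    finally show ?thesis using that by simp
  qed
  have "((\<lambda>l. \<Sum>B\<in>Pow E. ?t l B) \<longlongrightarrow> (\<Sum>B\<in>Pow E. ?t 0 B)) (at_right 0)"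
    by (intro tendsto_sum) (auto intro!: tendsto_eq_intros)
  moreover have "\<forall>\<^sub>F l in at_right 0. (\<Sum>B\<in>Pow E. ?t l B) = g E"
    using eventually_at_right_less[of 0] by eventually_elim (rule eq)
  ultimately have "((\<lambda>_. g E) \<longlongrightarrow> (\<Sum>B\<in>Pow E. ?t 0 B)) (at_right (0::real))"
    by (simp add: tendsto_cong)
  then have "g E = (\<Sum>B\<in>Pow E. ?t 0 B)"
    by (simp add: tendsto_const_iff)
  \<comment> \<open>At \<open>l = 0\<close> the power \<open>0 ^ (card B - r)\<close> removes larger
    sets and is 1 for \<open>card B = r\<close>.\<close>
  also have "\<dots> = (\<Sum>B | B \<subseteq> E \<and> card B = r. g B)"
    using assms(1) by (intro sum.mono_neutral_cong_right) (auto simp: power_0_left)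
  finally show ?thesis .
qed

section \<open>The Cauchy-Binet formula\<close>

lemma mdelta_gram_sum:
  assumes "finite E"
  shows "mdelta (gram n E a (\<lambda>_. 1)) =
    (\<Sum>B | B \<subseteq> E \<and> card B = n. mdelta (gram n B a (\<lambda>_. 1)))"
proof -
  \<comment> \<open>Column subsets become 0-1 weights on the fixed set \<open>E\<close>, so all
    values belong to one function of the weights.\<close>
  have sub: "gram n B a (\<lambda>_. 1) = gram n E a (\<lambda>e. if e \<in> B then 1 else 0)" if "B \<subseteq> E" for B
    using that assms unfolding gram_def
    by (intro eq_matI) (auto intro!: sum.mono_neutral_cong_left)
  have "l ^ n * mdelta (gram n F a (\<lambda>_. 1)) =
      (\<Sum>B\<in>Pow F. l ^ card B * (1 - l) ^ (card F - card B) * mdelta (gram n B a (\<lambda>_. 1)))"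
    if F: "F \<subseteq> E" and l: "0 \<le> l" for F l
  proof -
    \<comment> \<open>Homogeneity has degree \<open>n\<close>, the number of rows; the scaled
      indicator of \<open>F\<close> is then expanded in the variables of \<open>F\<close>.\<close>
    have "l ^ n * mdelta (gram n F a (\<lambda>_. 1)) =
        mdelta (gram n E a (\<lambda>e. l * (if e \<in> F then 1 else 0)))"
      unfolding sub[OF F] gram_scale using l by (simp add: mdelta_qreal_smult[of _ n])
    also have "\<dots> = mdelta (gram n E a (\<lambda>e. if e \<in> F then l else 0))"
      by (simp add: if_distrib cong: if_cong)
    also have "\<dots> = (\<Sum>B\<in>Pow F. l ^ card B * (1 - l) ^ (card F - card B) *
        mdelta (gram n E a (\<lambda>e. if e \<in> B then 1 else if e \<in> F then 0 else 0)))"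
    proof (rule multi_affine_expansion[of F l "\<lambda>_. 0" "\<lambda>w. mdelta (gram n E a w)"])
      show "mdelta (gram n E a (w(e := t))) =
          (1 - t) * mdelta (gram n E a (w(e := 0))) + t * mdelta (gram n E a (w(e := 1)))"
        if "e \<in> F" "\<And>e. 0 \<le> w e" "0 \<le> t" for w e t
        using that F by (intro mdelta_gram_affine[OF assms]) auto
    qed (use assms F l in \<open>auto intro: finite_subset\<close>)
    also have "\<dots> = (\<Sum>B\<in>Pow F. l ^ card B * (1 - l) ^ (card F - card B) *
        mdelta (gram n B a (\<lambda>_. 1)))"
      using F by (intro sum.cong refl) (auto simp: sub cong: if_cong)
    finally show ?thesis .
  qed
  then show ?thesis
    using homogeneous_expansion_sum[OF assms, of n "\<lambda>B. mdelta (gram n B a (\<lambda>_. 1))"] by blast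
qed

text \<open>\<open>P\<close> selects columns and is chosen before \<open>D\<close>, so reordering
  multiplies \<open>mdelta\<close> by the same factor for every \<open>D\<close>.\<close>

lemma ordered_mat_reorder_cols:
  assumes "length ys = length xs" "distinct xs" "set ys \<subseteq> set xs"
  obtains P where "P \<in> carrier_mat (length xs) (length xs)"
    and "\<And>D. ordered_mat xs ys D = ordered_mat xs xs D * P"
proof
  let ?n = "length xs"
  let ?P = "mat ?n ?n (\<lambda>(k, j). if xs ! k = ys ! j then 1 else 0 :: quat)"
  show "?P \<in> carrier_mat ?n ?n" by simp
  fix D :: "('a, 'a) qmat"
  show "ordered_mat xs ys D = ordered_mat xs xs D * ?P"
  proof (rule eq_matI)
    fix i j assume "i < dim_row (ordered_mat xs xs D * ?P)" "j < dim_col (ordered_mat xs xs D * ?P)"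
    then have ij: "i < ?n" "j < ?n" by (auto simp: ordered_mat_def)
    then obtain m where m: "m < ?n" "xs ! m = ys ! j"
      using assms by (metis in_set_conv_nth nth_mem subsetD)
    \<comment> \<open>Distinctness leaves a single nonzero entry in column \<open>j\<close> of
      \<open>?P\<close>.\<close>
    have "xs ! k = ys ! j \<longleftrightarrow> k = m" if "k < ?n" for k
      using that m assms(2) nth_eq_iff_index_eq by metis
    then have "(\<Sum>k = 0..<?n. D (xs ! i) (xs ! k) * (if xs ! k = ys ! j then 1 else 0)) =
        (\<Sum>k = 0..<?n. if k = m then D (xs ! i) (xs ! k) else 0)"
      by (intro sum.cong) auto
    also have "\<dots> = D (xs ! i) (ys ! j)" using m by simp
    finally show "ordered_mat xs ys D $$ (i, j) = (ordered_mat xs xs D * ?P) $$ (i, j)"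
      using ij assms(1) by (simp add: ordered_mat_def scalar_prod_def)
  qed (auto simp: ordered_mat_def assms(1))
qed

theorem theorem5p1:
  fixes r s :: nat
    and X :: "'x set" and E :: "'e set"
    and A :: "('x, 'e) qmat"
    and xs ys :: "'x list"
  assumes "r > 0" and "s > 0" and "s \<ge> r"
    and "finite X" and "finite E" and "card X = r" and "card E = s"
    and "distinct xs" and "set xs = X"
    and "distinct ys" and "set ys = X"
  shows "delta xs ys (qmat_mult E A (qadj A)) =
    (\<Sum>B | B \<subseteq> E \<and> card B = r.
       delta xs ys (qmat_mult B (qsubmat A X B) (qadj (qsubmat A X B))))"
proof -
  have len: "length xs = r" "length ys = r"
    using assms distinct_card by fastforce+
  obtain P where P: "P \<in> carrier_mat r r"
    and reorder: "\<And>D. ordered_mat xs ys D = ordered_mat xs xs D * P"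
    using ordered_mat_reorder_cols[of ys xs] assms len by auto
  define a where "a e i = A (xs ! i) e" for e i
  \<comment> \<open>The common factor \<open>mdelta P\<close> can be pulled out of the sum over
    \<open>B\<close>.\<close>
  have delta: "delta xs ys D = mdelta (ordered_mat xs xs D) * mdelta P" for D
    unfolding delta_eq_mdelta reorder
    using P len by (intro mdelta_mult) (auto simp: ordered_mat_def)
  have "ordered_mat xs xs (qmat_mult E A (qadj A)) = gram r E a (\<lambda>_. 1)"
    by (simp add: ordered_mat_def gram_def a_def qmat_mult_def qadj_def len)
  \<comment> \<open>The zero padding is never reached: all rows lie in \<open>X\<close> and the
    product sums over \<open>B\<close>.\<close>
  moreover have "ordered_mat xs xs (qmat_mult B (qsubmat A X B) (qadj (qsubmat A X B))) =
      gram r B a (\<lambda>_. 1)" for B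
    using assms len unfolding ordered_mat_def gram_def
    by (intro eq_matI) (auto simp: a_def qmat_mult_def qadj_def qsubmat_def intro!: sum.cong)
  ultimately show ?thesis
    unfolding delta by (simp add: mdelta_gram_sum[OF \<open>finite E\<close>] sum_distrib_right)
qed

end
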